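(* Let $\mathcal{U},\mathcal{V}$ be real Hilbert spaces and $b:\mathcal{U}\times\mathcal{V}\to\mathbb{R}$ a bilinear form satisfying Assumption 1, let $\mathcal{U}_h\subseteq\mathcal{U}$ and $\mathcal{V}_r\subseteq\mathcal{V}$ be finite-dimensional subspaces satisfying Assumption 3, let $\ell\in\mathrm{Range}(\mathcal{B})$ and $G\in\mathcal{U}'$ (all terms defined in the context). Let $\boldsymbol{u}^\star\in\mathcal{U}$ satisfy $b(\boldsymbol{u}^\star,\boldsymbol{v})=\ell(\boldsymbol{v})$ for all $\boldsymbol{v}\in\mathcal{V}$; let $\boldsymbol{v}^\star\in\mathcal{V}$ satisfy $b(\boldsymbol{u},\boldsymbol{v}^\star)=G(\boldsymbol{u})$ for all $\boldsymbol{u}\in\mathcal{U}$; let $\boldsymbol{u}_{h,r}\in\mathcal{U}_h$ be the solution of $b(\boldsymbol{u}_{h,r},\Theta_r\boldsymbol{w}_h)=\ell(\Theta_r\boldsymbol{w}_h)$ for all $\boldsymbol{w}_h\in\mathcal{U}_h$; and let $\boldsymbol{v}_{h,r}=\Theta_r\boldsymbol{\omega}_{h,r}$, where $\boldsymbol{\omega}_{h,r}\in\mathcal{U}_h$ is the solution of $b(\boldsymbol{u}_h,\Theta_r\boldsymbol{\omega}_{h,r})=G(\boldsymbol{u}_h)$ for all $\boldsymbol{u}_h\in\mathcal{U}_h$. Then for all $\boldsymbol{w}_h\in\mathcal{U}_h$, $$G(\boldsymbol{u}^\star-\boldsymbol{u}_{h,r})=b(\boldsymbol{u}^\star-\bo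ldsymbol{u}_{h,r},\boldsymbol{v}^\star-\Theta_r\boldsymbol{w}_h)=b(\boldsymbol{u}^\star-\boldsymbol{w}_h,\boldsymbol{v}^\star-\boldsymbol{v}_{h,r})=\ell(\boldsymbol{v}^\star-\boldsymbol{v}_{h,r}).$$
   Context: Infima and suprema of quotients are over nonzero elements. Assumption 1: $b$ is bounded, $\sup_{\boldsymbol{u}\in\mathcal{U}}\sup_{\boldsymbol{v}\in\mathcal{V}}\frac{b(\boldsymbol{u},\boldsymbol{v})}{\|\boldsymbol{u}\|_{\mathcal{U}}\|\boldsymbol{v}\|_{\mathcal{V}}}=M<\infty$, and $\inf_{\boldsymbol{u}\in\mathcal{U}}\sup_{\boldsymbol{v}\in\mathcal{V}}\frac{b(\boldsymbol{u},\boldsymbol{v})}{\|\boldsymbol{u}\|_{\mathcal{U}}\|\boldsymbol{v}\|_{\mathcal{V}}}=\gamma>0$. The operator $\mathcal{B}:\mathcal{U}\to\mathcal{V}'$ is $\langle\mathcal{B}\boldsymbol{u},\boldsymbol{v}\rangle=b(\boldsymbol{u},\boldsymbol{v})$. Assumption 3: there is a bounded linear operator $\Pi_r:\mathcal{V}\to\mathcal{V}_r$ with $b(\boldsymbol{u}_h,\boldsymbol{v}-\Pi_r\boldsymbol{v})=0$ for all $\boldsymbol{u}_h\in\mathcal{U}_h$, $\boldsymbol{v}\in\mathcal{V}$. (Under Assumptions 1 and 3 the two discrete problems in the claim have unique solutions $\boldsymbol{u}_{h,r}$, $\boldsymbol{\omega}_{h,r}$.) The approximate trial-to-test operator $\Theta_r:\mathcal{U}_h\to\mathcal{V}_r$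 is defined by $(\Theta_r\boldsymbol{w}_h,\boldsymbol{v}_r)_{\mathcal{V}}=b(\boldsymbol{w}_h,\boldsymbol{v}_r)$ for all $\boldsymbol{w}_h\in\mathcal{U}_h$, $\boldsymbol{v}_r\in\mathcal{V}_r$. *)

theory Defs
  imports "HOL-Analysis.Analysis"
begin

text \<open>
  Real Hilbert spaces are types of sort \<open>{real_inner, complete_space}\<close>, and the topological dual
  of such a type \<open>'a\<close> is \<open>'a \<Rightarrow>\<^sub>L real\<close>.
\<close>

text \<open>
  Infima and suprema of quotients are taken in \<^typ>\<open>ereal\<close>, since in \<^typ>\<open>real\<close> the
  supremum of an unbounded set is unspecified and boundedness could not be read off from it.
\<close>

definition continuity_constant ::
  "('u::real_normed_vector \<Rightarrow> 'v::real_normed_vector \<Rightarrow> real) \<Rightarrow> ereal" where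
  "continuity_constant b =
     (SUP u\<in>-{0}. SUP v\<in>-{0}. ereal (b u v / (norm u * norm v)))"

definition inf_sup_constant ::
  "('u::real_normed_vector \<Rightarrow> 'v::real_normed_vector \<Rightarrow> real) \<Rightarrow> ereal" where
  "inf_sup_constant b =
     (INF u\<in>-{0}. SUP v\<in>-{0}. ereal (b u v / (norm u * norm v)))"

definition bounded_inf_sup ::
  "('u::real_normed_vector \<Rightarrow> 'v::real_normed_vector \<Rightarrow> real) \<Rightarrow> bool" where
  "bounded_inf_sup b \<longleftrightarrow> continuity_constant b < \<infinity> \<and> 0 < inf_sup_constant b"

text \<open>
  The operator \<open>\<B>\<close> with \<open>\<langle>\<B> u, v\<rangle> = b u v\<close>. The constant \<^const>\<open>Blinfun\<close> is only specified on
  bounded linear maps; see \<open>form_operator_apply\<close> below.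
\<close>

definition form_operator ::
  "('u::real_normed_vector \<Rightarrow> 'v::real_normed_vector \<Rightarrow> real) \<Rightarrow> 'u \<Rightarrow> ('v \<Rightarrow>\<^sub>L real)" where
  "form_operator b u = Blinfun (b u)"

definition finite_dim_subspace :: "'a::real_vector set \<Rightarrow> bool" where
  "finite_dim_subspace S \<longleftrightarrow> subspace S \<and> (\<exists>B. finite B \<and> S = span B)"

definition fortin_operator ::
  "('u::real_normed_vector \<Rightarrow> 'v::real_normed_vector \<Rightarrow> real) \<Rightarrow> 'u set \<Rightarrow> 'v set \<Rightarrow> ('v \<Rightarrow> 'v) \<Rightarrow> bool"
  where
  "fortin_operator b Uh Vr P \<longleftrightarrow>
     bounded_linear P \<and> (\<forall>v. P v \<in> Vr) \<and> (\<forall>u\<in>Uh. \<forall>v. b u (v - P v) = 0)"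

text \<open>
  The approximate trial-to-test operator \<open>\<Theta>\<^sub>r\<close>. It is well defined for a bilinear form and a
  finite-dimensional \<open>Vr\<close>; see \<open>trial_to_test_ex1\<close> below.
\<close>

definition trial_to_test ::
  "('u::real_normed_vector \<Rightarrow> 'v::real_inner \<Rightarrow> real) \<Rightarrow> 'v set \<Rightarrow> 'u \<Rightarrow> 'v" where
  "trial_to_test b Vr w = (THE t. t \<in> Vr \<and> (\<forall>v\<in>Vr. t \<bullet> v = b w v))"

lemma form_operator_apply:
  assumes "bilinear b" and "continuity_constant b < \<infinity>"
  shows "blinfun_apply (form_operator b u) v = b u v"
proof -
  have lin: "linear (b u)" "linear (\<lambda>u. b u v)" for u v
    using assms(1) by (auto simp: bilinear_def)
  obtain M where M: "continuity_constant b \<le> ereal M"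
    using assms(2) by (metis ereal_cases order_refl ereal_infty_less(1) ereal_less_eq(2))
  have le: "b u v \<le> M * (norm u * norm v)" for u v
  proof (cases "u = 0 \<or> v = 0")
    case True
    then show ?thesis using linear_0[OF lin(1)] linear_0[OF lin(2)] by auto
  next
    case False
    then have "ereal (b u v / (norm u * norm v)) \<le> continuity_constant b"
      unfolding continuity_constant_def by (intro SUP_upper2[of u] SUP_upper2[of v]) auto
    then have "b u v / (norm u * norm v) \<le> M"
      using M by (metis order_trans ereal_less_eq(3))
    then show ?thesis using False by (simp add: field_simps)
  qed
  have "bounded_linear (b u)"
  proof (rule bounded_linear_intro[where K = "M * norm u"])
    show "b u (x + y) = b u x + b u y" for x y using linear_add[OF lin(1)] .
    show "b u (r *\<^sub>R x) = r *\<^sub>R b u x" for r x using linear_scale[OF lin(1)] .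
    show "norm (b u x) \<le> norm x * (M * norm u)" for x
      using le[of u x] le[of u "- x"] linear_neg[OF lin(1), of u x] by (simp add: algebra_simps)
  qed
  then show ?thesis
    by (simp add: form_operator_def bounded_linear_Blinfun_apply)
qed

lemma finite_span_riesz:
  fixes f :: "'v::real_inner \<Rightarrow> real"
  assumes "finite B" and "linear f"
  shows "\<exists>t\<in>span B. \<forall>v\<in>span B. t \<bullet> v = f v"
  using assms
proof (induction B arbitrary: f rule: finite_induct)
  case empty
  then show ?case by (simp add: linear_0)
next
  case (insert a B)
  obtain p where p: "p \<in> span B" "\<forall>v\<in>span B. p \<bullet> v = a \<bullet> v"
    using insert.IH[of "\<lambda>v. a \<bullet> v"] bounded_linear.linear[OF bounded_linear_inner_right] by blast
  obtain t where t: "t \<in> span B" "\<forall>v\<in>span B. t \<bullet> v = f v"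
    using insert.IH[of f] insert.prems by blast
  define c where "c = a - p"
  have orth: "c \<bullet> v = 0" if "v \<in> span B" for v
    using that p(2) by (simp add: c_def inner_diff_left)
  define s where "s = t + (f c / (c \<bullet> c)) *\<^sub>R c"
  have sub: "span B \<subseteq> span (insert a B)" by (intro span_mono) auto
  have cin: "c \<in> span (insert a B)"
    unfolding c_def using sub p(1) by (intro span_diff) (auto intro: span_base)
  have "s \<in> span (insert a B)"
    unfolding s_def using sub t(1) cin by (intro span_add span_scale) auto
  moreover have "s \<bullet> v = f v" if "v \<in> span (insert a B)" for v
  proof -
    obtain k where "v - k *\<^sub>R a \<in> span B" using \<open>v \<in> _\<close> by (auto simp: span_insert)
    then have w: "v - k *\<^sub>R a + k *\<^sub>R p \<in> span B" using p(1) by (intro span_add span_scale)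
    define w where "w = v - k *\<^sub>R a + k *\<^sub>R p"
    have v: "v = w + k *\<^sub>R c" by (simp add: w_def c_def algebra_simps)
    have wB: "w \<in> span B" using w by (simp add: w_def)
    have tc: "t \<bullet> c = 0" using orth[OF t(1)] by (simp add: inner_commute)
    have "s \<bullet> v = f w + k * f c"
      using orth[OF wB] t(2) wB tc linear_0[OF insert.prems]
      by (cases "c = 0") (simp_all add: s_def v inner_add_left inner_add_right)
    also have "\<dots> = f v"
      by (simp add: v linear_add[OF insert.prems] linear_scale[OF insert.prems])
    finally show ?thesis .
  qed
  ultimately show ?case by blast
qed

lemma trial_to_test_ex1:
  assumes "bilinear b" and "finite_dim_subspace Vr"
  shows "\<exists>!t. t \<in> Vr \<and> (\<forall>v\<in>Vr. t \<bullet> v = b w v)"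
proof -
  have "linear (b w)" using assms(1) by (auto simp: bilinear_def)
  then obtain t where t: "t \<in> Vr \<and> (\<forall>v\<in>Vr. t \<bullet> v = b w v)"
    using assms(2) finite_span_riesz unfolding finite_dim_subspace_def by blast
  show ?thesis
  proof (intro ex1I[where a = t])
    show "t \<in> Vr \<and> (\<forall>v\<in>Vr. t \<bullet> v = b w v)" by (rule t)
  next
    fix s assume s: "s \<in> Vr \<and> (\<forall>v\<in>Vr. s \<bullet> v = b w v)"
    then have "s - t \<in> Vr"
      using t assms(2) by (auto simp: finite_dim_subspace_def intro: subspace_diff)
    then have "(s - t) \<bullet> (s - t) = 0" using s t by (simp add: inner_diff_left)
    then show "s = t" by simp
  qed
qed

end

theory Submission
  imports Defs
begin

text \<open>Two Galerkin orthogonalities carry the result: \<open>ustar - uhr\<close> is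
  \<open>b\<close>-orthogonal to every test function \<open>trial_to_test b Vr w\<close> with
  \<open>w\<close> in \<open>Uh\<close>, and \<open>vstar - vhr\<close> is
  \<open>b\<close>-orthogonal to all of \<open>Uh\<close>. The outer equalities follow by dropping
  orthogonal terms. The middle one holds because both sides equal
  \<open>b (ustar - uhr) (vstar - vhr)\<close>.\<close>

theorem theorem4p2:
  fixes b :: "'u::{real_inner, complete_space} \<Rightarrow> 'v::{real_inner, complete_space} \<Rightarrow> real"
    and Uh :: "'u set" and Vr :: "'v set"
    and l :: "'v \<Rightarrow>\<^sub>L real" and G :: "'u \<Rightarrow>\<^sub>L real"
    and ustar uhr \<omega>hr :: 'u and vstar vhr :: 'v
  assumes "bilinear b"
    and "bounded_inf_sup b"
    and "finite_dim_subspace Uh"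
    and "finite_dim_subspace Vr"
    and "\<exists>P. fortin_operator b Uh Vr P"
    and "l \<in> range (form_operator b)"
    and "\<forall>v. b ustar v = l v"
    and "\<forall>u. b u vstar = G u"
    and "uhr \<in> Uh"
    and "\<forall>wh\<in>Uh. b uhr (trial_to_test b Vr wh) = l (trial_to_test b Vr wh)"
    and "\<omega>hr \<in> Uh"
    and "\<forall>uh\<in>Uh. b uh (trial_to_test b Vr \<omega>hr) = G uh"
    and "vhr = trial_to_test b Vr \<omega>hr"
  shows "\<forall>wh\<in>Uh.
      G (ustar - uhr) = b (ustar - uhr) (vstar - trial_to_test b Vr wh) \<and>
      b (ustar - uhr) (vstar - trial_to_test b Vr wh) = b (ustar - wh) (vstar - vhr) \<and>
      b (ustar - wh) (vstar - vhr) = l (vstar - vhr)"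
proof
  fix wh assume "wh \<in> Uh"
  have lin: "linear (b u)" "linear (\<lambda>u. b u v)" for u v
    using assms(1) by (auto simp: bilinear_def)
  note diff = linear_diff[OF lin(1)] linear_diff[OF lin(2)]
  have primal: "b (ustar - uhr) (trial_to_test b Vr w) = 0" if "w \<in> Uh" for w
    using that assms(7,10) by (simp add: diff)
  have dual: "b w (vstar - vhr) = 0" if "w \<in> Uh" for w
    using that assms(8,12,13) by (simp add: diff)
  have "G (ustar - uhr) = b (ustar - uhr) vstar"
    using assms(8) by simp
  \<comment> \<open>Kept for arbitrary \<open>w\<close>, since it is needed both at
    \<open>wh\<close> and at \<open>\<omega>hr\<close>, where the test function is
    \<open>vhr\<close>.\<close>
  moreover have "b (ustar - uhr) (vstar - trial_to_test b Vr w) = b (ustar - uhr) vstar"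
    if "w \<in> Uh" for w
    using primal[OF that] by (simp add: diff(1))
  moreover have "b (ustar - w) (vstar - vhr) = l (vstar - vhr)" if "w \<in> Uh" for w
    using dual[OF that] assms(7) by (simp add: diff(2))
  \<comment> \<open>The two chains meet at \<open>b (ustar - uhr) (vstar - vhr)\<close>: take
    \<open>w = \<omega>hr\<close> in the primal identity and \<open>w = uhr\<close> in the dual
    one.\<close>
  ultimately show "G (ustar - uhr) = b (ustar - uhr) (vstar - trial_to_test b Vr wh) \<and>
      b (ustar - uhr) (vstar - trial_to_test b Vr wh) = b (ustar - wh) (vstar - vhr) \<and>
      b (ustar - wh) (vstar - vhr) = l (vstar - vhr)"
    using \<open>wh \<in> Uh\<close> assms(9,11,13) by metis
qed

end
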